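(* Let $n>2$ be a natural number and let $\tau$ be an irreducible unitary representation of the dihedral group $D_{2n}$ acting in a finite-dimensional complex vector space $\mathbf{H}_\tau$. 1. If $\tau$ is a character (i.e. $\dim\mathbf{H}_\tau=1$), then for any nonzero complex number $z$, $\tau(D_{2n})z$ has the Haar property. 2. If $\tau$ is not a character and $n$ is prime, then for almost every vector $v\in\mathbf{H}_\tau$, $\tau(D_{2n})v$ has the Haar property. 3. If $\tau$ is not a character and $n$ is even, then there does not exist a vector $v\in\mathbf{H}_\tau$ such that $\tau(D_{2n})v$ has the Haar property. 4. Suppose that $n$ is a composite odd natural number. (a) There exists an irreducible unitary representation $\tau'$ of $D_{2n}$ acting in some $\mathbf{H}_{\tau'}$ such that for every vector $v\in\mathbf{H}_{\tau'}$, $\tau'(D_{2n})v$ does not have the Haar property. (b) There exists an irreducible unitary representation $\tau''$ of $D_{2n}$ acting in some $\mathbf{H}_{\tau''}$ such that for almost every vector $v\in\mathbf{H}_{\tau''}$, $\tau''(D_{2n})v$ has the Haar property.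
   Context: $D_{2n}=\langle r,s : r^n=s^2=e,\ srs=r^{n-1}\rangle$ is the dihedral group of order $2n$. A character is a homomorphism into the circle group, viewed as a one-dimensional unitary representation on $\mathbb{C}$. "Almost every" is with respect to Lebesgue measure on the complex vector space. Haar property: for a representation $\tau$ of $G=D_{2n}$ on a $d$-dimensional space $\mathbf{H}_\tau$ and $v\in\mathbf{H}_\tau$, the orbit $\tau(G)v$ is regarded as the family $(\tau(x)v)_{x\in G}$ indexed by the group elements. It has the Haar property if for every subset $K\subseteq G$ of cardinality $d$, the vectors $(\tau(x)v)_{x\in K}$ form a basis of $\mathbf{H}_\tau$. Equivalently, writing $D_{2n}=\{x_1,\dots,x_{2n}\}$, every minor of order $d$ of the $2n\times d$ matrix whose $i$-th row is the coordinate vector of $\tau(x_i)v$ is nonzero. *)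

theory Defs
  imports "HOL-Analysis.Analysis" "HOL-Algebra.Generated_Groups" "HOL-Library.Function_Algebras"
begin

text \<open>
  The presentation determines a group of order \<open>2 * n\<close>; the order condition excludes its proper
  quotients, so the predicate below pins down the dihedral group up to isomorphism.
\<close>

locale dihedral_group = group G for n :: nat and G (structure) and r s +
  assumes r_closed: "r \<in> carrier G"
    and s_closed: "s \<in> carrier G"
    and r_pow: "r [^] n = \<one>"
    and s_pow: "s [^] (2::nat) = \<one>"
    and srs: "s \<otimes> r \<otimes> s = r [^] (n - 1)"
    and generated: "generate G {r, s} = carrier G"
    and order_eq: "order G = 2 * n"

text \<open>
  The pair \<open>(i, b)\<close> stands for \<open>r ^ i * s ^ b\<close>; this model shows that the
  predicate is satisfiable.
\<close>

definition dihedral_model :: "nat \<Rightarrow> (int \<times> bool) monoid" where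
  "dihedral_model n = \<lparr>carrier = {0..<int n} \<times> UNIV,
     mult = (\<lambda>(i, b) (j, c). ((if b then i - j else i + j) mod int n, b \<noteq> c)),
     one = (0, False)\<rparr>"

lemma dihedral_group_model:
  assumes "n > 1"
  shows "dihedral_group n (dihedral_model n) (1, False) (0, True)"
proof -
  let ?G = "dihedral_model n"
  have grp: "group ?G"
  proof (rule groupI)
    fix x assume "x \<in> carrier ?G"
    then obtain i b where x: "x = (i, b)" "0 \<le> i" "i < int n"
      by (auto simp: dihedral_model_def)
    have "(if b then i else (- i) mod int n, b) \<in> carrier ?G"
      "(if b then i else (- i) mod int n, b) \<otimes>\<^bsub>?G\<^esub> x = \<one>\<^bsub>?G\<^esub>"
      using x assms by (auto simp: dihedral_model_def mod_simps)
    then show "\<exists>y\<in>carrier ?G. y \<otimes>\<^bsub>?G\<^esub> x = \<one>\<^bsub>?G\<^esub>" by blast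
  qed (use assms in \<open>auto simp: dihedral_model_def mod_simps algebra_simps\<close>)
  interpret group ?G by (fact grp)
  have rp: "(1, False) [^]\<^bsub>?G\<^esub> k = (int k mod int n, False)" for k :: nat
  proof (induction k)
    case 0
    then show ?case by (simp add: dihedral_model_def)
  next
    case (Suc k)
    then show ?case by (simp add: nat_pow_Suc) (simp add: dihedral_model_def mod_simps add.commute)
  qed
  have cl: "(1, False) \<in> carrier ?G" "(0, True) \<in> carrier ?G"
    using assms by (auto simp: dihedral_model_def)
  have "(i, b) \<in> generate ?G {(1, False), (0, True)}" if "0 \<le> i" "i < int n" for i b
  proof -
    have i: "(1, False) [^]\<^bsub>?G\<^esub> k \<in> generate ?G {(1, False), (0, True)}" for k :: nat
    proof (induction k)
      case 0
      then show ?case by (simp add: generate.one)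
    next
      case (Suc k)
      then show ?case by (simp add: nat_pow_Suc generate.eng generate.incl)
    qed
    have r: "(i, False) \<in> generate ?G {(1, False), (0, True)}"
      using i[of "nat i"] that by (simp add: rp)
    have "(i, False) \<otimes>\<^bsub>?G\<^esub> (0, True) \<in> generate ?G {(1, False), (0, True)}"
      by (rule generate.eng[OF r generate.incl]) simp
    then have "(i, True) \<in> generate ?G {(1, False), (0, True)}"
      using that by (simp add: dihedral_model_def)
    with r show ?thesis by (cases b) auto
  qed
  then have "carrier ?G \<subseteq> generate ?G {(1, False), (0, True)}"
    by (auto simp: dihedral_model_def)
  moreover have "generate ?G {(1, False), (0, True)} \<subseteq> carrier ?G"
    using cl by (intro generate_incl) auto
  moreover have "order ?G = 2 * n"
    by (simp add: order_def dihedral_model_def card_cartesian_product)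
  moreover have "(0, True) [^]\<^bsub>?G\<^esub> (2::nat) = \<one>\<^bsub>?G\<^esub>"
    using cl by (simp add: numeral_2_eq_2) (simp add: dihedral_model_def)
  moreover have "(0, True) \<otimes>\<^bsub>?G\<^esub> (1, False) \<otimes>\<^bsub>?G\<^esub> (0, True) = (1, False) [^]\<^bsub>?G\<^esub> (n - 1)"
    unfolding rp using assms by (simp add: dihedral_model_def zmod_minus1 of_nat_diff)
  moreover have "(1, False) [^]\<^bsub>?G\<^esub> n = \<one>\<^bsub>?G\<^esub>"
    by (simp add: rp) (simp add: dihedral_model_def)
  ultimately show ?thesis
    using cl by unfold_locales auto
qed

text \<open>
  A finite-dimensional complex inner product space, given as a subspace \<open>H\<close> of an ambient complex
  vector space. Only the values of \<open>ip\<close> on \<open>H\<close> matter.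
\<close>

locale fin_dim_unitary_space = vector_space scl
  for scl :: "complex \<Rightarrow> 'v::ab_group_add \<Rightarrow> 'v" +
  fixes H :: "'v set" and ip :: "'v \<Rightarrow> 'v \<Rightarrow> complex"
  assumes subspace_H: "subspace H"
    and fin_dim: "\<exists>B. finite B \<and> span B = H"
    and ip_add: "\<lbrakk>u \<in> H; v \<in> H; w \<in> H\<rbrakk> \<Longrightarrow> ip (u + v) w = ip u w + ip v w"
    and ip_scale: "\<lbrakk>u \<in> H; v \<in> H\<rbrakk> \<Longrightarrow> ip (scl c u) v = c * ip u v"
    and ip_sym: "\<lbrakk>u \<in> H; v \<in> H\<rbrakk> \<Longrightarrow> ip v u = cnj (ip u v)"
    and ip_pos: "\<lbrakk>u \<in> H; u \<noteq> 0\<rbrakk> \<Longrightarrow> Re (ip u u) > 0"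

definition unitary_operator ::
  "(complex \<Rightarrow> 'v::ab_group_add \<Rightarrow> 'v) \<Rightarrow> 'v set \<Rightarrow> ('v \<Rightarrow> 'v \<Rightarrow> complex) \<Rightarrow> ('v \<Rightarrow> 'v) \<Rightarrow> bool" where
  "unitary_operator scl H ip U \<longleftrightarrow>
     U ` H = H \<and>
     (\<forall>u\<in>H. \<forall>v\<in>H. U (u + v) = U u + U v) \<and>
     (\<forall>c. \<forall>u\<in>H. U (scl c u) = scl c (U u)) \<and>
     (\<forall>u\<in>H. \<forall>v\<in>H. ip (U u) (U v) = ip u v)"

locale unitary_rep = group G + fin_dim_unitary_space scl H ip
  for G (structure) and scl :: "complex \<Rightarrow> 'v::ab_group_add \<Rightarrow> 'v" and H ip +
  fixes \<tau> :: "'g \<Rightarrow> 'v \<Rightarrow> 'v"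
  assumes rep_unitary: "x \<in> carrier G \<Longrightarrow> unitary_operator scl H ip (\<tau> x)"
    and rep_mult: "\<lbrakk>x \<in> carrier G; y \<in> carrier G; v \<in> H\<rbrakk> \<Longrightarrow> \<tau> (x \<otimes> y) v = \<tau> x (\<tau> y v)"

locale irreducible_unitary_rep = unitary_rep +
  assumes nonzero: "H \<noteq> {0}"
    and irreducible:
      "\<lbrakk>subspace W; W \<subseteq> H; \<And>x. x \<in> carrier G \<Longrightarrow> \<tau> x ` W \<subseteq> W\<rbrakk> \<Longrightarrow> W = {0} \<or> W = H"

text \<open>A basis as a family: repeated vectors are not allowed, hence the injectivity.\<close>

definition basis_family ::
  "(complex \<Rightarrow> 'v::ab_group_add \<Rightarrow> 'v) \<Rightarrow> 'v set \<Rightarrow> 'i set \<Rightarrow> ('i \<Rightarrow> 'v) \<Rightarrow> bool" where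
  "basis_family scl H I b \<longleftrightarrow>
     inj_on b I \<and> \<not> module.dependent scl (b ` I) \<and> module.span scl (b ` I) = H"

definition haar_property ::
  "('g, 'm) monoid_scheme \<Rightarrow> (complex \<Rightarrow> 'v::ab_group_add \<Rightarrow> 'v) \<Rightarrow> 'v set \<Rightarrow>
     ('g \<Rightarrow> 'v \<Rightarrow> 'v) \<Rightarrow> 'v \<Rightarrow> bool" where
  "haar_property G scl H \<tau> v \<longleftrightarrow>
     (\<forall>K \<subseteq> carrier G. card K = vector_space.dim scl H \<longrightarrow>
        basis_family scl H K (\<lambda>x. \<tau> x v))"

text \<open>
  Lebesgue measure on \<open>H\<close> is transported from \<open>\<complex> ^ d\<close> along a linear coordinate system. A change of
  basis only rescales it, so the notion of null set does not depend on the basis.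
\<close>

definition almost_every_vector ::
  "(complex \<Rightarrow> 'v::ab_group_add \<Rightarrow> 'v) \<Rightarrow> 'v set \<Rightarrow> ('v \<Rightarrow> bool) \<Rightarrow> bool" where
  "almost_every_vector scl H P \<longleftrightarrow>
     (let d = vector_space.dim scl H in
      \<forall>b :: nat \<Rightarrow> 'v. basis_family scl H {..<d} b \<longrightarrow>
        (AE c in Pi\<^sub>M {..<d} (\<lambda>_. lborel :: complex measure). P (\<Sum>i<d. scl (c i) (b i))))"

end

theory Submission
  imports Defs
begin

text \<open>
  In an irreducible representation the rotation \<open>r\<close>, being of finite order, has an eigenvector \<open>e\<close>, say
  for the eigenvalue \<open>\<zeta>\<close>, and \<open>f = \<tau> s e\<close> is an eigenvector for the inverse of \<open>\<zeta>\<close>. The span of \<open>e\<close> and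
  \<open>f\<close> is invariant, so the dimension is one or two. In dimension one the
  group moves a nonzero vector to nonzero vectors, each of which is a basis. In dimension two,
  irreducibility forces \<open>\<zeta>\<^sup>2 \<noteq> 1\<close> (\<open>irreducible_eigenbasis\<close>), and in the basis \<open>e, f\<close> the orbit of \<open>v = (a, b)\<close> is explicit:
  \<open>r\<^sup>k v = (\<zeta>\<^sup>k a, \<zeta>\<^sup>-\<^sup>k b)\<close> and \<open>r\<^sup>k s v = (\<zeta>\<^sup>k b, \<zeta>\<^sup>-\<^sup>k a)\<close>.

  In dimension two the Haar property says that the orbit vectors of two distinct group elements are never
  proportional. Every determinant of such a pair is, up to a nonzero factor, either
  \<open>a b (\<zeta> ^ (2 m) - 1)\<close> with \<open>0 < m < n\<close> or a difference \<open>\<zeta> ^ (2 k) a\<^sup>2 - \<zeta> ^ (2 l) b\<^sup>2\<close>, that is, a product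
  of two nonzero linear forms in \<open>(a, b)\<close>. Hence, if no \<open>\<zeta> ^ (2 m)\<close> with \<open>0 < m < n\<close> is \<open>1\<close>, the
  exceptional vectors lie in a finite union of lines, a null set
  (\<open>almost_every_vector_haar_property\<close>). If \<open>n > 2\<close> is prime, this applies to every \<open>\<zeta>\<close> with
  \<open>\<zeta>\<^sup>n = 1\<close> and \<open>\<zeta>\<^sup>2 \<noteq> 1\<close>; if \<open>n\<close> is odd, it applies to a primitive \<open>n\<close>-th root of unity.

  Conversely, in dimension two the Haar property fails for every vector as soon as a nontrivial
  group element acts as a scalar. For even \<open>n\<close> this happens for \<open>r ^ (n div 2)\<close>; for \<open>n = p q\<close> odd and composite it
  happens for \<open>r ^ q\<close> when \<open>\<zeta>\<close> is a primitive \<open>q\<close>-th root of unity. For both roots of unity the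
  representation is constructed on the functions \<open>nat \<Rightarrow> complex\<close> supported on \<open>{0, 1}\<close>.
\<close>

section \<open>Normal form of the elements of a dihedral group\<close>

context dihedral_group
begin

definition normal_form :: "nat \<Rightarrow> bool \<Rightarrow> 'a" where
  "normal_form k b = r [^] k \<otimes> (if b then s else \<one>)"

lemma normal_form_closed [simp]: "normal_form k b \<in> carrier G"
  using r_closed s_closed by (simp add: normal_form_def)

lemma s_mult_s: "s \<otimes> s = \<one>"
  using s_pow s_closed by (simp add: numeral_2_eq_2)

lemma s_r: "s \<otimes> r = r [^] (n - 1) \<otimes> s"
proof -
  have "s \<otimes> r = (s \<otimes> r \<otimes> s) \<otimes> s"
    using r_closed s_closed s_mult_s by (simp add: m_assoc)
  then show ?thesis by (simp add: srs)
qed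

lemma s_r_pow: "s \<otimes> r [^] (k::nat) = r [^] ((n - 1) * k) \<otimes> s"
proof (induction k)
  case 0
  show ?case using s_closed by simp
next
  case (Suc k)
  have "s \<otimes> r [^] Suc k = (s \<otimes> r [^] k) \<otimes> r"
    using r_closed s_closed by (simp add: m_assoc)
  also have "\<dots> = r [^] ((n - 1) * k) \<otimes> (s \<otimes> r)"
    using r_closed s_closed by (simp add: Suc m_assoc)
  also have "\<dots> = (r [^] ((n - 1) * k) \<otimes> r [^] (n - 1)) \<otimes> s"
    using r_closed s_closed by (simp only: s_r) (simp add: m_assoc)
  also have "\<dots> = r [^] ((n - 1) * Suc k) \<otimes> s"
    using r_closed by (simp add: nat_pow_mult add.commute)
  finally show ?case .
qed

lemma normal_form_mult:
  "normal_form k b \<otimes> normal_form l c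
     = normal_form (k + (if b then (n - 1) * l else l)) (b \<noteq> c)"
proof (cases b)
  case True
  let ?t = "if c then s else \<one>"
  have t: "?t \<in> carrier G" using s_closed by simp
  have "normal_form k b \<otimes> normal_form l c = r [^] k \<otimes> ((s \<otimes> r [^] l) \<otimes> ?t)"
    using True r_closed s_closed t by (simp add: normal_form_def m_assoc)
  also have "\<dots> = (r [^] k \<otimes> r [^] ((n - 1) * l)) \<otimes> (s \<otimes> ?t)"
    using r_closed s_closed t by (simp only: s_r_pow) (simp add: m_assoc)
  also have "\<dots> = r [^] (k + (n - 1) * l) \<otimes> (s \<otimes> ?t)"
    using r_closed by (simp add: nat_pow_mult)
  finally show ?thesis using True s_closed s_mult_s by (simp add: normal_form_def)
next
  case False
  then show ?thesis
    using r_closed s_closed by (simp add: normal_form_def m_assoc[symmetric] nat_pow_mult)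
qed

lemma r_pow_mod: "r [^] (k mod n) = r [^] (k::nat)"
proof -
  have "r [^] k = r [^] (n * (k div n) + k mod n)" by simp
  also have "\<dots> = (r [^] n) [^] (k div n) \<otimes> r [^] (k mod n)"
    using r_closed by (simp only: nat_pow_mult[symmetric] nat_pow_pow)
  finally show ?thesis using r_closed by (simp add: r_pow)
qed

lemma normal_form_mod: "normal_form (k mod n) b = normal_form k b"
  by (simp add: normal_form_def r_pow_mod)

lemma normal_form_special:
  "normal_form 0 False = \<one>" "normal_form 1 False = r" "normal_form 0 True = s"
  using r_closed s_closed by (simp_all add: normal_form_def)

lemma carrier_normal_form:
  assumes "n > 0"
  shows "carrier G = case_prod normal_form ` ({..<n} \<times> UNIV)"
proof -
  have inv_r: "inv r = normal_form (n - 1) False"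
  proof (rule inv_equality)
    show "normal_form (n - 1) False \<otimes> r = \<one>"
      using assms r_closed by (simp add: normal_form_def r_pow flip: nat_pow_Suc)
  qed (use r_closed in auto)
  have inv_s: "inv s = s"
    using s_mult_s s_closed by (intro inv_equality) auto
  have range: "\<exists>k b. x = normal_form k b" if "x \<in> generate G {r, s}" for x
    using that
  proof (induction rule: generate.induct)
    case one
    show ?case by (metis normal_form_special(1))
  next
    case (incl h)
    then show ?case by (metis empty_iff insert_iff normal_form_special(2,3))
  next
    case (inv h)
    then show ?case by (metis empty_iff insert_iff inv_r inv_s normal_form_special(3))
  next
    case (eng h1 h2)
    then show ?case by (metis normal_form_mult)
  qed
  have "carrier G \<subseteq> range (case_prod normal_form)"
    using range unfolding generated by fast
  moreover have "range (case_prod normal_form) \<subseteq> case_prod normal_form ` ({..<n} \<times> UNIV)"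
  proof
    fix x assume "x \<in> range (case_prod normal_form)"
    then obtain k b where "x = normal_form k b" by auto
    then show "x \<in> case_prod normal_form ` ({..<n} \<times> UNIV)"
      using assms by (intro image_eqI[of _ _ "(k mod n, b)"]) (auto simp: normal_form_mod)
  qed
  ultimately show ?thesis by auto
qed

lemma carrier_cases:
  assumes "n > 0" "x \<in> carrier G"
  obtains k b where "k < n" "x = normal_form k b"
  using assms carrier_normal_form by auto

text \<open>
  The \<open>2 * n\<close> normal forms exhaust a group of order \<open>2 * n\<close>, so no two of them coincide.
\<close>

lemma inj_on_normal_form:
  assumes "n > 0"
  shows "inj_on (case_prod normal_form) ({..<n} \<times> UNIV)"
proof (rule eq_card_imp_inj_on)
  show "card (case_prod normal_form ` ({..<n} \<times> (UNIV :: bool set))) = card ({..<n} \<times> (UNIV :: bool set))"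
    using carrier_normal_form[OF assms] order_eq by (simp add: order_def card_cartesian_product)
qed simp

lemma normal_form_eq_iff:
  assumes "n > 0"
  shows "normal_form k b = normal_form l c \<longleftrightarrow> k mod n = l mod n \<and> b = c"
  using inj_onD[OF inj_on_normal_form[OF assms], of "(k mod n, b)" "(l mod n, c)"] assms
    normal_form_mod[of k b] normal_form_mod[of l c]
  by auto

end

section \<open>Linear forms and coordinates\<close>

text \<open>
  A proper hyperplane is a null set by Fubini: once the other coordinates are fixed, the equation
  determines the \<open>i\<close>-th coordinate, and points are null in \<open>\<complex>\<close>.
\<close>

lemma AE_lborel_linear_form_nonzero:
  fixes \<alpha> :: "'i \<Rightarrow> complex"
  assumes "finite I" "i \<in> I" "\<alpha> i \<noteq> 0"
  shows "AE c in Pi\<^sub>M I (\<lambda>_. lborel :: complex measure). (\<Sum>j\<in>I. c j * \<alpha> j) \<noteq> 0"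
proof -
  interpret product_sigma_finite "\<lambda>_ :: 'i. lborel :: complex measure" by standard
  let ?J = "I - {i}"
  let ?M = "Pi\<^sub>M I (\<lambda>_. lborel :: complex measure)"
  define N where "N = {c \<in> space ?M. (\<Sum>j\<in>I. c j * \<alpha> j) = 0}"
  have I: "insert i ?J = I" using assms by auto
  have N: "N \<in> sets ?M" unfolding N_def by measurable
  have "emeasure ?M N = (\<integral>\<^sup>+ c. indicator N c \<partial>Pi\<^sub>M (insert i ?J) (\<lambda>_. lborel))"
    unfolding I using N by simp
  also have "\<dots> = (\<integral>\<^sup>+ c. (\<integral>\<^sup>+ y. indicator N (c(i := y)) \<partial>lborel) \<partial>Pi\<^sub>M ?J (\<lambda>_. lborel))"
    by (rule product_nn_integral_insert) (use assms N I in auto)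
  also have "\<dots> = (\<integral>\<^sup>+ c. 0 \<partial>Pi\<^sub>M ?J (\<lambda>_. lborel :: complex measure))"
  proof (rule nn_integral_cong)
    fix c :: "'i \<Rightarrow> complex"
    let ?y = "- (\<Sum>j\<in>?J. c j * \<alpha> j) / \<alpha> i"
    have "y = ?y" if "c(i := y) \<in> N" for y
    proof -
      have "(\<Sum>j\<in>?J. (c(i := y)) j * \<alpha> j) = (\<Sum>j\<in>?J. c j * \<alpha> j)"
        by (rule sum.cong) auto
      then have "y * \<alpha> i + (\<Sum>j\<in>?J. c j * \<alpha> j) = 0"
        using that assms by (simp add: N_def sum.remove[of I i])
      then show ?thesis using assms by (simp add: field_simps eq_neg_iff_add_eq_0)
    qed
    then have "(\<integral>\<^sup>+ y. indicator N (c(i := y)) \<partial>lborel) \<le> (\<integral>\<^sup>+ y. indicator {?y} y \<partial>lborel)"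
      by (intro nn_integral_mono) (auto simp: indicator_def)
    also have "\<dots> = 0" by simp
    finally show "(\<integral>\<^sup>+ y. indicator N (c(i := y)) \<partial>lborel) = (0 :: ennreal)" by simp
  qed
  finally have "emeasure ?M N = 0" by simp
  then show ?thesis by (intro AE_I[OF _ _ N]) (auto simp: N_def)
qed

context vector_space
begin

lemma independent_card_dim_spans:
  assumes "subspace H" "finite C" "H \<subseteq> span C"
    and "independent B" "B \<subseteq> H" "card B = dim H"
  shows "span B = H"
proof -
  obtain B' where B': "B \<subseteq> B'" "B' \<subseteq> H" "independent B'" "H \<subseteq> span B'"
    using maximal_independent_subset_extend[OF assms(5,4)] by metis
  have "finite B'"
    using independent_span_bound[OF assms(2) B'(3)] B'(2) assms(3) by auto
  moreover have "card B' = dim H" using basis_card_eq_dim B' by blast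
  ultimately have "B = B'" using B'(1) assms(6) by (metis card_subset_eq)
  with B' assms(1) show ?thesis by (metis span_minimal subset_antisym)
qed

end

context fin_dim_unitary_space
begin

text \<open>
  In coordinates \<open>c\<close> with respect to a basis \<open>b\<close>, the form \<open>\<phi>\<close> has coefficients \<open>\<phi> (b i)\<close>. They do not
  all vanish, because \<open>b\<close> spans and \<open>\<phi>\<close> is nonzero on \<open>H\<close>.
\<close>

lemma almost_every_vector_linear_form_nonzero:
  fixes \<phi> :: "'v \<Rightarrow> complex"
  assumes add: "\<And>u v. u \<in> H \<Longrightarrow> v \<in> H \<Longrightarrow> \<phi> (u + v) = \<phi> u + \<phi> v"
    and scale: "\<And>c v. v \<in> H \<Longrightarrow> \<phi> (scl c v) = c * \<phi> v"
    and nonzero: "w \<in> H" "\<phi> w \<noteq> 0"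
  shows "almost_every_vector scl H (\<lambda>v. \<phi> v \<noteq> 0)"
  unfolding almost_every_vector_def Let_def
proof (intro allI impI)
  fix b :: "nat \<Rightarrow> 'v"
  let ?I = "{..<dim H}"
  assume b: "basis_family scl H ?I b"
  then have span_b: "span (b ` ?I) = H" by (simp add: basis_family_def)
  then have b_H: "b i \<in> H" if "i < dim H" for i
    using that span_superset[of "b ` ?I"] by auto
  have zero: "\<phi> 0 = 0" using scale[of 0 0] subspace_0[OF subspace_H] by simp
  have sum: "(\<Sum>i\<in>A. scl (c i) (b i)) \<in> H \<and> \<phi> (\<Sum>i\<in>A. scl (c i) (b i)) = (\<Sum>i\<in>A. c i * \<phi> (b i))"
    if "A \<subseteq> ?I" "finite A" for A c
    using that(2,1)
  proof (induction A rule: finite_induct)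
    case empty
    then show ?case using zero subspace_0[OF subspace_H] by simp
  next
    case (insert i A)
    then have "b i \<in> H" using b_H by auto
    then show ?case
      using insert by (simp add: add scale subspace_add subspace_scale subspace_H)
  qed
  have "\<exists>i\<in>?I. \<phi> (b i) \<noteq> 0"
  proof (rule ccontr)
    assume none: "\<not> ?thesis"
    have "span (b ` ?I) \<subseteq> {v \<in> H. \<phi> v = 0}"
    proof (rule span_minimal)
      show "subspace {v \<in> H. \<phi> v = 0}"
        using zero subspace_H by (auto simp: subspace_def add scale)
    qed (use none b_H in auto)
    with span_b nonzero show False by auto
  qed
  then obtain i where "i \<in> ?I" "\<phi> (b i) \<noteq> 0" by blast
  then have "AE c in Pi\<^sub>M ?I (\<lambda>_. lborel :: complex measure). (\<Sum>i\<in>?I. c i * \<phi> (b i)) \<noteq> 0"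
    by (intro AE_lborel_linear_form_nonzero) auto
  then show "AE c in Pi\<^sub>M ?I (\<lambda>_. lborel :: complex measure). \<phi> (\<Sum>i<dim H. scl (c i) (b i)) \<noteq> 0"
    using sum[of ?I] by simp
qed

lemma almost_every_vector_finite_conj:
  assumes "finite A" "\<And>a. a \<in> A \<Longrightarrow> almost_every_vector scl H (P a)"
    and "\<And>v. v \<in> H \<Longrightarrow> (\<forall>a\<in>A. P a v) \<Longrightarrow> Q v"
  shows "almost_every_vector scl H Q"
  unfolding almost_every_vector_def Let_def
proof (intro allI impI)
  fix b :: "nat \<Rightarrow> 'v"
  assume b: "basis_family scl H {..<dim H} b"
  then have span_b: "span (b ` {..<dim H}) = H" by (simp add: basis_family_def)
  have in_H: "(\<Sum>i<dim H. scl (c i) (b i)) \<in> H" for c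
    by (subst span_b[symmetric]) (intro span_sum span_scale span_base imageI)
  have "AE c in Pi\<^sub>M {..<dim H} (\<lambda>_. lborel :: complex measure).
          \<forall>a\<in>A. P a (\<Sum>i<dim H. scl (c i) (b i))"
    using assms(1,2) b by (intro AE_finite_allI) (auto simp: almost_every_vector_def Let_def)
  then show "AE c in Pi\<^sub>M {..<dim H} (\<lambda>_. lborel :: complex measure).
          Q (\<Sum>i<dim H. scl (c i) (b i))"
    by (rule AE_mp) (use assms(3) in_H in auto)
qed

end

section \<open>Unitary representations\<close>

context unitary_rep
begin

lemma rep_image_H: "x \<in> carrier G \<Longrightarrow> \<tau> x ` H = H"
  using rep_unitary[of x] by (simp only: unitary_operator_def)

lemma rep_in_H: "x \<in> carrier G \<Longrightarrow> v \<in> H \<Longrightarrow> \<tau> x v \<in> H"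
  using imageI[of v H "\<tau> x"] by (simp only: rep_image_H)

lemma rep_add: "x \<in> carrier G \<Longrightarrow> u \<in> H \<Longrightarrow> v \<in> H \<Longrightarrow> \<tau> x (u + v) = \<tau> x u + \<tau> x v"
  using rep_unitary[of x] by (simp only: unitary_operator_def)

lemma rep_scale: "x \<in> carrier G \<Longrightarrow> v \<in> H \<Longrightarrow> \<tau> x (scl c v) = scl c (\<tau> x v)"
  using rep_unitary[of x] by (simp only: unitary_operator_def)

lemma rep_zero: "x \<in> carrier G \<Longrightarrow> \<tau> x 0 = 0"
  using rep_scale[of x 0 0] subspace_0[OF subspace_H] by simp

lemma rep_sum:
  assumes "x \<in> carrier G" "finite A" "\<And>i. i \<in> A \<Longrightarrow> g i \<in> H"
  shows "\<tau> x (\<Sum>i\<in>A. g i) = (\<Sum>i\<in>A. \<tau> x (g i))"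
  using assms(2,3)
  by (induction A rule: finite_induct)
    (simp_all add: rep_zero rep_add assms(1) subspace_sum[OF subspace_H])

lemma rep_one:
  assumes "v \<in> H"
  shows "\<tau> \<one> v = v"
proof -
  have "v \<in> \<tau> \<one> ` H" using assms by (simp only: rep_image_H one_closed)
  then obtain u where u: "v = \<tau> \<one> u" "u \<in> H" by (rule imageE)
  have "\<tau> (\<one> \<otimes> \<one>) u = \<tau> \<one> (\<tau> \<one> u)" using u by (intro rep_mult) auto
  then show ?thesis unfolding u(1) by (simp only: l_one one_closed)
qed

lemma rep_eq_0:
  assumes "x \<in> carrier G" "v \<in> H" "\<tau> x v = 0"
  shows "v = 0"
  using assms rep_mult[of "inv x" x v] by (simp add: rep_one rep_zero)

lemma haar_property_dim_1:
  assumes "vector_space.dim scl H = 1" "z \<in> H" "z \<noteq> 0"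
  shows "haar_property G scl H \<tau> z"
  unfolding haar_property_def
proof (intro allI impI)
  fix K assume "K \<subseteq> carrier G" "card K = vector_space.dim scl H"
  then obtain x where K: "K = {x}" and x: "x \<in> carrier G"
    using assms(1) by (auto simp: card_1_singleton_iff)
  have "\<tau> x z \<noteq> 0" using rep_eq_0[OF x assms(2)] assms(3) by metis
  then have ind: "independent {\<tau> x z}" by simp
  obtain C where C: "finite C" "span C = H" using fin_dim by (elim exE conjE)
  have "span {\<tau> x z} = H"
    by (rule independent_card_dim_spans[OF subspace_H C(1) _ ind])
      (simp_all add: C(2) rep_in_H x assms(1,2))
  then show "basis_family scl H K (\<lambda>x. \<tau> x z)"
    using ind by (simp add: basis_family_def K)
qed

end

lemma cis_power_eq_1_iff:
  assumes "n > 0"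
  shows "cis (2 * pi / real n) ^ k = 1 \<longleftrightarrow> n dvd k"
proof -
  have eq: "\<i> * complex_of_real (real k * (2 * pi / real n)) = 2 * of_real pi * \<i> * of_nat k / of_nat n"
    by simp
  have "cis (2 * pi / real n) ^ k = cis (real k * (2 * pi / real n))" by (rule Complex.DeMoivre)
  also have "\<dots> = exp (2 * of_real pi * \<i> * of_nat k / of_nat n)"
    unfolding cis_conv_exp eq ..
  finally show ?thesis using complex_root_unity_eq_1[of n k] assms by simp
qed

text \<open>
  Every vector \<open>w\<close> is the average of its Fourier components \<open>p j = (\<Sum>k<n. \<omega> ^ (j * k) x\<^sup>k w)\<close>, and each
  component that does not vanish is an eigenvector of \<open>x\<close> with eigenvalue \<open>\<omega> ^ (- j)\<close>.
\<close>

lemma (in unitary_rep) finite_order_eigenvector: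
  assumes x: "x \<in> carrier G" "x [^] n = \<one>" and n: "n > (0 :: nat)" and "H \<noteq> {0}"
  obtains e \<zeta> where "e \<in> H" "e \<noteq> 0" "\<tau> x e = scl \<zeta> e"
proof -
  obtain w where w: "w \<in> H" "w \<noteq> 0"
    using \<open>H \<noteq> {0}\<close> subspace_0[OF subspace_H] by blast
  define \<omega> where "\<omega> = cis (2 * pi / real n)"
  have \<omega>_pow: "\<omega> ^ k = 1 \<longleftrightarrow> n dvd k" for k
    unfolding \<omega>_def using cis_power_eq_1_iff[OF n] .
  have \<omega>_nz: "\<omega> \<noteq> 0" by (simp add: \<omega>_def)
  define g where "g j k = scl (\<omega> ^ (j * k)) (\<tau> (x [^] k) w)" for j k :: nat
  define p where "p j = (\<Sum>k<n. g j k)" for j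
  have g_H: "g j k \<in> H" for j k
    unfolding g_def using x w by (simp add: rep_in_H subspace_scale subspace_H)
  have rep_g: "\<tau> x (g j k) = scl (inverse (\<omega> ^ j)) (g j (Suc k))" for j k
  proof -
    have "\<tau> x (\<tau> (x [^] k) w) = \<tau> (x [^] Suc k) w"
      using x w rep_mult[of x "x [^] k" w] nat_pow_Suc2[of x k] by simp
    then show ?thesis
      using x w \<omega>_nz by (simp add: g_def rep_scale rep_in_H power_add)
  qed
  have "\<tau> x (p j) = scl (inverse (\<omega> ^ j)) (p j)" for j
  proof -
    have "g j n = g j 0"
      using x \<omega>_pow[of "j * n"] by (simp add: g_def)
    then have "(\<Sum>k<n. g j (Suc k)) = p j"
      using sum.lessThan_Suc_shift[of "g j" n] by (simp add: p_def add.commute)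
    then show ?thesis
      unfolding p_def using x g_H by (simp add: rep_sum rep_g flip: scale_sum_right)
  qed
  moreover have "p j \<in> H" for j
    unfolding p_def using g_H by (intro subspace_sum[OF subspace_H])
  moreover have "\<exists>j. p j \<noteq> 0"
  proof (rule ccontr)
    assume none: "\<not> ?thesis"
    have orth: "(\<Sum>j<n. \<omega> ^ (j * k)) = (if k = 0 then of_nat n else 0)" if "k < n" for k
    proof (cases "k = 0")
      case False
      then have "\<omega> ^ k \<noteq> 1" using that \<omega>_pow[of k] by (auto dest: dvd_imp_le)
      moreover have "(\<omega> ^ k) ^ n = 1" using \<omega>_pow[of "k * n"] by (simp add: power_mult)
      ultimately have "(\<Sum>j<n. (\<omega> ^ k) ^ j) = 0" by (simp add: geometric_sum)
      then show ?thesis using False by (simp add: mult.commute flip: power_mult)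
    qed simp
    \<comment> \<open>By orthogonality of the characters of \<open>\<int> / n\<close>, the components add up to \<open>n\<close> times \<open>w\<close>.\<close>
    have "0 = (\<Sum>j<n. p j)" using none by simp
    also have "\<dots> = (\<Sum>k<n. scl (\<Sum>j<n. \<omega> ^ (j * k)) (\<tau> (x [^] k) w))"
      unfolding p_def g_def by (subst sum.swap) (simp add: scale_sum_left)
    also have "\<dots> = (\<Sum>k<n. if k = 0 then scl (of_nat n) (\<tau> (x [^] k) w) else 0)"
      by (intro sum.cong refl) (simp add: orth)
    also have "\<dots> = scl (of_nat n) w"
      using n w by (simp add: rep_one)
    finally show False using n w by simp
  qed
  ultimately show thesis using that by blast
qed

section \<open>Dihedral representations in a basis swapped by the reflection\<close>

locale dihedral_rep = dihedral_group n G r s + unitary_rep G scl H ip \<tau>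
  for n and G (structure) and r s and scl :: "complex \<Rightarrow> 'v::ab_group_add \<Rightarrow> 'v" and H ip \<tau> +
  assumes n_gt_2: "n > 2"
begin

lemma invariant_if_generators:
  assumes "W \<subseteq> H" "\<tau> r ` W \<subseteq> W" "\<tau> s ` W \<subseteq> W" "x \<in> carrier G"
  shows "\<tau> x ` W \<subseteq> W"
proof -
  obtain k b where x: "x = normal_form k b"
    using carrier_cases assms(4) n_gt_2 by (metis less_trans zero_less_numeral)
  have pow: "\<tau> (r [^] (k :: nat)) w \<in> W" if "w \<in> W" for k w
    using that
  proof (induction k arbitrary: w)
    case 0
    then have "w \<in> H" by (intro subsetD[OF assms(1)])
    then show ?case using 0 by (simp add: rep_one)
  next
    case (Suc k)
    then have "w \<in> H" by (intro subsetD[OF assms(1)])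
    then have "\<tau> (r [^] Suc k) w = \<tau> (r [^] k) (\<tau> r w)"
      using rep_mult[OF nat_pow_closed[OF r_closed] r_closed] by simp
    moreover have "\<tau> r w \<in> W" using assms(2) Suc.prems by (rule subsetD[OF _ imageI])
    ultimately show ?case using Suc.IH by simp
  qed
  have "\<tau> x w \<in> W" if w: "w \<in> W" for w
  proof (cases b)
    case True
    have "\<tau> x w = \<tau> (r [^] k) (\<tau> s w)"
      using True rep_mult[OF nat_pow_closed[OF r_closed] s_closed subsetD[OF assms(1) w]]
      by (simp add: x normal_form_def)
    then show ?thesis using pow assms(3) w by (simp add: image_subset_iff)
  next
    case False
    then show ?thesis using pow[OF w] r_closed by (simp add: x normal_form_def)
  qed
  then show ?thesis by blast
qed

lemma span_invariant:
  assumes "B \<subseteq> H" "\<And>b. b \<in> B \<Longrightarrow> \<tau> r b \<in> span B" "\<And>b. b \<in> B \<Longrightarrow> \<tau> s b \<in> span B"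
    and "x \<in> carrier G"
  shows "\<tau> x ` span B \<subseteq> span B"
proof (rule invariant_if_generators)
  show sub: "span B \<subseteq> H" using assms(1) subspace_H by (rule span_minimal)
  have "\<tau> y ` span B \<subseteq> span B" if y: "y \<in> carrier G" "\<And>b. b \<in> B \<Longrightarrow> \<tau> y b \<in> span B" for y
  proof -
    have "span B \<subseteq> {w \<in> H. \<tau> y w \<in> span B}"
    proof (rule span_minimal)
      show "subspace {w \<in> H. \<tau> y w \<in> span B}"
        using subspace_H y(1)
        by (auto simp: subspace_def rep_zero rep_add rep_scale span_zero span_add span_scale)
    qed (use assms(1) y(2) in auto)
    then show ?thesis by auto
  qed
  then show "\<tau> r ` span B \<subseteq> span B" "\<tau> s ` span B \<subseteq> span B"
    using r_closed s_closed assms(2,3) by auto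
qed (rule assms(4))

lemma rep_r_pow_eigenvector:
  assumes "v \<in> H" "\<tau> r v = scl c v"
  shows "\<tau> (r [^] (k :: nat)) v = scl (c ^ k) v"
proof (induction k)
  case 0
  show ?case using rep_one assms(1) by simp
next
  case (Suc k)
  then show ?case
    using rep_mult[of "r [^] k" r v] r_closed assms
    by (simp add: rep_scale mult.commute)
qed

text \<open>
  The reflection conjugates \<open>r\<close> into its inverse \<open>r ^ (n - 1)\<close>, hence turns an eigenvector for \<open>c\<close>
  into one for the inverse eigenvalue.
\<close>

lemma rep_r_reflected_eigenvector:
  assumes "v \<in> H" "\<tau> r v = scl c v"
  shows "\<tau> r (\<tau> s v) = scl (c ^ (n - 1)) (\<tau> s v)"
proof -
  have "s \<otimes> r [^] (n - 1) = s \<otimes> (s \<otimes> r \<otimes> s)" by (simp only: srs)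
  also have "\<dots> = (s \<otimes> s) \<otimes> (r \<otimes> s)" using r_closed s_closed by (simp add: m_assoc)
  finally have "r \<otimes> s = s \<otimes> r [^] (n - 1)" using r_closed s_closed by (simp add: s_mult_s)
  then have "\<tau> r (\<tau> s v) = \<tau> s (\<tau> (r [^] (n - 1)) v)"
    using rep_mult[of r s v] rep_mult[of s "r [^] (n - 1)" v] r_closed s_closed assms(1) by simp
  also have "\<dots> = scl (c ^ (n - 1)) (\<tau> s v)"
    unfolding rep_r_pow_eigenvector[OF assms] by (rule rep_scale[OF s_closed assms(1)])
  finally show ?thesis .
qed

end

text \<open>
  The common shape of all representations of dimension two considered below: an eigenvector of
  the rotation and its mirror image form a basis.
\<close>

locale dihedral_plane = dihedral_rep +
  fixes e :: 'c and \<zeta> :: complex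
  assumes e_H: "e \<in> H"
    and rep_r_e: "\<tau> r e = scl \<zeta> e"
    and ind: "independent {e, \<tau> s e}"
    and e_neq: "e \<noteq> \<tau> s e"
    and H_span: "H \<subseteq> span {e, \<tau> s e}"
begin

abbreviation "f \<equiv> \<tau> s e"

definition vec :: "complex \<Rightarrow> complex \<Rightarrow> 'c" where
  "vec a b = scl a e + scl b f"

lemma f_H: "f \<in> H" by (rule rep_in_H[OF s_closed e_H])

lemma vec_H [simp]: "vec a b \<in> H"
  unfolding vec_def
  by (rule subspace_add[OF subspace_H subspace_scale subspace_scale, OF subspace_H e_H subspace_H f_H])

lemma H_eq_span: "H = span {e, f}"
proof (rule subset_antisym[OF H_span span_minimal[OF _ subspace_H]])
  show "{e, f} \<subseteq> H" using e_H f_H by simp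
qed

lemma dim_H: "dim H = 2"
proof -
  have "dim H = dim {e, f}" by (subst H_eq_span) (rule dim_span)
  also have "\<dots> = card {e, f}" by (rule dim_eq_card_independent[OF ind])
  also have "\<dots> = 2" using e_neq by simp
  finally show ?thesis .
qed

lemma H_cases:
  assumes "v \<in> H" obtains a b where "v = vec a b"
proof -
  have "v \<in> span {e, f}" by (rule subsetD[OF H_span assms])
  then obtain a where "v - scl a e \<in> span {f}" unfolding span_insert by blast
  then obtain b where "v - scl a e = scl b f" unfolding span_singleton by blast
  then have "v = vec a b" by (simp add: vec_def algebra_simps)
  then show thesis by (rule that)
qed

definition coord_e :: "'c \<Rightarrow> complex" where "coord_e v = representation {e, f} v e"
definition coord_f :: "'c \<Rightarrow> complex" where "coord_f v = representation {e, f} v f"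

lemma coord_add:
  assumes "u \<in> H" "v \<in> H"
  shows "coord_e (u + v) = coord_e u + coord_e v" "coord_f (u + v) = coord_f u + coord_f v"
  using representation_add[OF ind assms(2,1)[THEN subsetD[OF H_span]]]
  by (simp_all add: coord_e_def coord_f_def)

lemma coord_scale:
  assumes "v \<in> H"
  shows "coord_e (scl c v) = c * coord_e v" "coord_f (scl c v) = c * coord_f v"
  using representation_scale[OF ind assms[THEN subsetD[OF H_span]]]
  by (simp_all add: coord_e_def coord_f_def)

lemma coord_vec [simp]: "coord_e (vec a b) = a" "coord_f (vec a b) = b"
proof -
  have ef: "coord_e e = 1" "coord_e f = 0" "coord_f e = 0" "coord_f f = 1"
    using representation_basis[OF ind, of e] representation_basis[OF ind, of f] e_neq
    by (auto simp: coord_e_def coord_f_def)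
  have sc: "scl c e \<in> H" "scl c f \<in> H" for c
    by (simp_all add: subspace_scale subspace_H e_H f_H)
  show "coord_e (vec a b) = a" "coord_f (vec a b) = b"
    unfolding vec_def by (simp_all add: coord_add coord_scale sc e_H f_H ef)
qed

lemma vec_eq_iff [simp]: "vec a b = vec c d \<longleftrightarrow> a = c \<and> b = d"
  by (metis coord_vec)

lemma scale_vec: "scl c (vec a b) = vec (c * a) (c * b)"
  by (simp add: vec_def scale_right_distrib)

lemma add_vec: "vec a b + vec c d = vec (a + c) (b + d)"
  by (simp add: vec_def scale_left_distrib algebra_simps)

lemma vec_axes: "vec 0 0 = 0" "vec 1 0 = e" "vec 0 1 = f"
  by (simp_all add: vec_def)

lemma vec_eq_0_iff [simp]: "vec a b = 0 \<longleftrightarrow> a = 0 \<and> b = 0"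
  using vec_eq_iff[of a b 0 0] by (simp only: vec_axes)

lemma rep_r_pow_e: "\<tau> (r [^] (k :: nat)) e = scl (\<zeta> ^ k) e"
  by (rule rep_r_pow_eigenvector[OF e_H rep_r_e])

lemma \<zeta>_pow_n: "\<zeta> ^ n = 1"
proof -
  have "scl (\<zeta> ^ n) e = e"
    using rep_r_pow_e[of n] unfolding r_pow rep_one[OF e_H] by (rule sym)
  then have "vec (\<zeta> ^ n * 1) (\<zeta> ^ n * 0) = vec 1 0"
    by (simp only: vec_axes flip: scale_vec)
  then show ?thesis by simp
qed

text \<open>
  The inverse of \<open>\<zeta>\<close>, written as a power so that it matches the relation for \<open>srs\<close>.
\<close>

definition \<eta> :: complex where "\<eta> = \<zeta> ^ (n - 1)"

lemma \<zeta>_mult_\<eta>: "\<zeta> * \<eta> = 1"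
  using \<zeta>_pow_n n_gt_2 by (simp add: \<eta>_def flip: power_Suc)

lemma \<zeta>_nonzero: "\<zeta> \<noteq> 0"
  using \<zeta>_mult_\<eta> by auto

lemma \<zeta>_pow_mult_\<eta>_pow: "\<zeta> ^ k * \<eta> ^ k = 1"
  by (simp add: \<zeta>_mult_\<eta> flip: power_mult_distrib)

lemma rep_r_pow_f: "\<tau> (r [^] (k :: nat)) f = scl (\<eta> ^ k) f"
  unfolding \<eta>_def by (rule rep_r_pow_eigenvector[OF f_H rep_r_reflected_eigenvector[OF e_H rep_r_e]])

lemma rep_s_f: "\<tau> s f = e"
  using rep_mult[of s s e] s_closed e_H rep_one by (simp add: s_mult_s)

lemma rep_vec:
  "\<tau> (normal_form k b) (vec p q)
     = vec (\<zeta> ^ k * (if b then q else p)) (\<eta> ^ k * (if b then p else q))"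
proof -
  have sc: "scl c e \<in> H" "scl c f \<in> H" for c
    by (simp_all add: subspace_scale subspace_H e_H f_H)
  have r: "\<tau> (r [^] k) (vec p q) = vec (\<zeta> ^ k * p) (\<eta> ^ k * q)" for p q
    using r_closed
    by (simp add: vec_def rep_add rep_scale sc e_H f_H rep_r_pow_e rep_r_pow_f mult.commute)
  have s: "\<tau> s (vec p q) = vec q p"
    using s_closed by (simp add: vec_def rep_add rep_scale sc e_H f_H rep_s_f add.commute)
  show ?thesis
    using rep_mult[of "r [^] k" s "vec p q"] r_closed s_closed
    by (auto simp: normal_form_def r s)
qed

lemma rep_r_vec: "\<tau> r (vec p q) = vec (\<zeta> * p) (\<eta> * q)"
  using rep_vec[of 1 False p q] by (simp only: normal_form_special power_one_right if_False)

lemma rep_s_vec: "\<tau> s (vec p q) = vec q p"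
  using rep_vec[of 0 True p q] by (simp only: normal_form_special power_0 if_True mult_1)

lemma basis_family_vec:
  assumes "g x = vec p q" "g y = vec p' q'" and det: "p * q' \<noteq> p' * q"
  shows "basis_family scl H {x, y} g"
proof -
  have "g x \<notin> span {g y}"
    using det by (auto simp: assms(1,2) span_singleton scale_vec mult_ac)
  moreover have "g y \<noteq> 0" using det by (auto simp: assms(1,2))
  ultimately have "independent {g x, g y}" by (simp add: independent_insert)
  moreover have neq: "g x \<noteq> g y" using det by (auto simp: assms(1,2))
  moreover have "span {g x, g y} = H"
    by (rule independent_card_dim_spans[OF subspace_H, of "{e, f}"])
      (use calculation H_span dim_H in \<open>auto simp: assms\<close>)
  ultimately show ?thesis by (auto simp: basis_family_def inj_on_def)
qed

text \<open>
  The obstruction to the Haar property in dimension two: two group elements that move \<open>v\<close> to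
  proportional vectors.
\<close>

lemma not_haar_property_if_scalar:
  assumes "x \<in> carrier G" "y \<in> carrier G" "x \<noteq> y" and "\<tau> x v = scl c (\<tau> y v)"
  shows "\<not> haar_property G scl H \<tau> v"
proof
  assume "haar_property G scl H \<tau> v"
  then have "basis_family scl H {x, y} (\<lambda>x. \<tau> x v)"
    using assms(1-3) dim_H by (auto simp: haar_property_def)
  then have "\<tau> x v \<noteq> \<tau> y v" "independent {\<tau> x v, \<tau> y v}"
    using assms(3) by (auto simp: basis_family_def)
  then have "\<tau> x v \<notin> span {\<tau> y v}" by (simp add: independent_insert)
  then show False using assms(4) by (auto simp: span_singleton)
qed

text \<open>
  Each condition keeps one family of determinants away from zero. Two rotations (or two
  reflections) with exponents \<open>k\<close> and \<open>l\<close> give \<open>\<plusminus> p q (\<zeta> ^ (k - l) - \<zeta> ^ (l - k))\<close>; a rotation and a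
  reflection give \<open>\<plusminus> (\<zeta> ^ (k - l) p\<^sup>2 - \<zeta> ^ (l - k) q\<^sup>2)\<close>, which factors into two linear forms.
\<close>

lemma haar_property_vec:
  assumes order: "\<And>m. 0 < m \<Longrightarrow> m < n \<Longrightarrow> \<zeta> ^ (2 * m) \<noteq> 1"
    and nz: "p \<noteq> 0" "q \<noteq> 0"
    and axes: "\<And>k l. k < n \<Longrightarrow> l < n \<Longrightarrow> \<zeta> ^ k * p \<noteq> \<zeta> ^ l * q \<and> \<zeta> ^ k * p \<noteq> - (\<zeta> ^ l * q)"
  shows "haar_property G scl H \<tau> (vec p q)"
  unfolding haar_property_def
proof (intro allI impI)
  fix K assume K: "K \<subseteq> carrier G" "card K = dim H"
  then obtain x y where xy: "K = {x, y}" "x \<noteq> y" by (auto simp: dim_H card_2_iff)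
  obtain k b where x: "k < n" "x = normal_form k b"
    using carrier_cases[of x] K(1) xy n_gt_2 by auto
  obtain l c where y: "l < n" "y = normal_form l c"
    using carrier_cases[of y] K(1) xy n_gt_2 by auto
  \<comment> \<open>Multiplying a vanishing determinant by \<open>\<zeta> ^ (k + l)\<close> removes the inverse \<open>\<eta>\<close>.\<close>
  have clear: "\<zeta> ^ (2 * k) * A = \<zeta> ^ (2 * l) * B"
    if "\<zeta> ^ k * \<eta> ^ l * A = \<zeta> ^ l * \<eta> ^ k * B" for k l A B
  proof -
    have sq: "\<zeta> ^ (2 * j) = \<zeta> ^ j * \<zeta> ^ j" for j by (simp add: mult_2 power_add)
    have "\<zeta> ^ (2 * k) * (\<zeta> ^ l * \<eta> ^ l) * A = (\<zeta> ^ k * \<zeta> ^ l) * (\<zeta> ^ k * \<eta> ^ l * A)"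
      unfolding sq by (simp only: mult_ac)
    also have "\<dots> = \<zeta> ^ (2 * l) * (\<zeta> ^ k * \<eta> ^ k) * B"
      unfolding that sq by (simp only: mult_ac)
    finally show ?thesis by (simp add: \<zeta>_pow_mult_\<eta>_pow)
  qed
  have rot: "\<zeta> ^ k * \<eta> ^ l \<noteq> \<zeta> ^ l * \<eta> ^ k" if "k < l" "l < n" for k l
  proof
    assume "\<zeta> ^ k * \<eta> ^ l = \<zeta> ^ l * \<eta> ^ k"
    then have "\<zeta> ^ (2 * k) = \<zeta> ^ (2 * l)" using clear[of k l 1 1] by simp
    also have "\<dots> = \<zeta> ^ (2 * k) * \<zeta> ^ (2 * (l - k))"
      using that by (simp flip: power_add distrib_left)
    finally have "\<zeta> ^ (2 * (l - k)) = 1" using \<zeta>_nonzero by simp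
    then show False using order[of "l - k"] that by simp
  qed
  have refl: "\<zeta> ^ k * \<eta> ^ l * p\<^sup>2 \<noteq> \<zeta> ^ l * \<eta> ^ k * q\<^sup>2" if "k < n" "l < n" for k l
  proof
    assume "\<zeta> ^ k * \<eta> ^ l * p\<^sup>2 = \<zeta> ^ l * \<eta> ^ k * q\<^sup>2"
    then have "(\<zeta> ^ k * p)\<^sup>2 = (\<zeta> ^ l * q)\<^sup>2"
      by (drule_tac clear) (simp add: power_mult_distrib flip: power_mult mult.commute[of 2])
    then show False using axes[OF that] by (simp add: power2_eq_iff)
  qed
  have "(\<zeta> ^ k * (if b then q else p)) * (\<eta> ^ l * (if c then p else q))
      \<noteq> (\<zeta> ^ l * (if c then q else p)) * (\<eta> ^ k * (if b then p else q))"
  proof (cases "b = c")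
    case True
    then have "k \<noteq> l" using x y xy by auto
    then have "\<zeta> ^ k * \<eta> ^ l \<noteq> \<zeta> ^ l * \<eta> ^ k"
      using rot[of k l] rot[of l k] x y by (metis nat_neq_iff)
    then have "(\<zeta> ^ k * \<eta> ^ l) * (p * q) \<noteq> (\<zeta> ^ l * \<eta> ^ k) * (p * q)"
      using nz by simp
    then show ?thesis using True by (auto simp: mult_ac)
  next
    case False
    then show ?thesis
      using refl[of k l] refl[of l k] x y by (auto simp: power2_eq_square mult_ac)
  qed
  then show "basis_family scl H K (\<lambda>x. \<tau> x (vec p q))"
    unfolding xy(1) by (intro basis_family_vec) (simp_all only: x y rep_vec)
qed

text \<open>
  The conditions on \<open>(p, q)\<close> in the preceding criterion say that finitely many nonzero linear forms
  do not vanish at the vector. The set \<open>F\<close> in the proof lists their coefficients.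
\<close>

lemma almost_every_vector_haar_property:
  assumes order: "\<And>m. 0 < m \<Longrightarrow> m < n \<Longrightarrow> \<zeta> ^ (2 * m) \<noteq> 1"
  shows "almost_every_vector scl H (haar_property G scl H \<tau>)"
proof -
  define F where "F = {(1, 0), (0, 1)} \<union>
    (\<lambda>(k, l, t). (\<zeta> ^ k, t * \<zeta> ^ l)) ` ({..<n} \<times> {..<n} \<times> {1, -1})"
  have form: "(\<zeta> ^ k, t * \<zeta> ^ l) \<in> F" if "k < n" "l < n" "t = 1 \<or> t = -1" for k l t
    unfolding F_def using that by (intro UnI2 image_eqI[of _ _ "(k, l, t)"]) auto
  show ?thesis
  proof (rule almost_every_vector_finite_conj
      [of F "\<lambda>(\<alpha>, \<beta>) v. \<alpha> * coord_e v + \<beta> * coord_f v \<noteq> 0"])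
    show "finite F" by (simp add: F_def)
  next
    fix \<phi> assume "\<phi> \<in> F"
    then obtain \<alpha> \<beta> where \<phi>: "\<phi> = (\<alpha>, \<beta>)" "\<alpha> \<noteq> 0 \<or> \<beta> \<noteq> 0"
      using \<zeta>_nonzero by (auto simp: F_def)
    define w where "w = (if \<alpha> \<noteq> 0 then vec 1 0 else vec 0 1)"
    have "almost_every_vector scl H (\<lambda>v. \<alpha> * coord_e v + \<beta> * coord_f v \<noteq> 0)"
    proof (rule almost_every_vector_linear_form_nonzero[of _ w])
      show "\<alpha> * coord_e w + \<beta> * coord_f w \<noteq> 0" using \<phi> by (simp add: w_def)
    qed (simp_all add: coord_add coord_scale w_def algebra_simps)
    then show "almost_every_vector scl H
        ((\<lambda>(\<alpha>, \<beta>) v. \<alpha> * coord_e v + \<beta> * coord_f v \<noteq> 0) \<phi>)"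
      by (simp add: \<phi>)
  next
    fix v assume "v \<in> H" and F: "\<forall>\<phi>\<in>F. (\<lambda>(\<alpha>, \<beta>) v. \<alpha> * coord_e v + \<beta> * coord_f v \<noteq> 0) \<phi> v"
    then obtain p q where v: "v = vec p q" using H_cases by blast
    have F': "\<alpha> * p + \<beta> * q \<noteq> 0" if "(\<alpha>, \<beta>) \<in> F" for \<alpha> \<beta>
      using bspec[OF F that] by (simp add: v)
    show "haar_property G scl H \<tau> v"
      unfolding v
    proof (rule haar_property_vec[OF order])
      show "p \<noteq> 0" "q \<noteq> 0" using F'[of 1 0] F'[of 0 1] by (auto simp: F_def)
      show "\<zeta> ^ k * p \<noteq> \<zeta> ^ l * q \<and> \<zeta> ^ k * p \<noteq> - (\<zeta> ^ l * q)" if "k < n" "l < n" for k l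
        using F'[OF form[OF that, of 1]] F'[OF form[OF that, of "-1"]]
        by (auto simp: add_eq_0_iff)
    qed
  qed
qed

text \<open>
  When \<open>\<zeta>\<close> differs from its inverse, the two eigenlines of the rotation are distinguished by it and
  exchanged by \<open>s\<close>, so a nonzero invariant subspace contains both.
\<close>

lemma irreducible_plane:
  assumes "\<zeta> ^ 2 \<noteq> 1"
  shows "irreducible_unitary_rep G scl H ip \<tau>"
proof
  have "vec 1 0 \<in> H" "vec 1 0 \<noteq> 0" by simp_all
  then show "H \<noteq> {0}" by (metis singletonD)
  fix W assume W: "subspace W" "W \<subseteq> H" and inv: "\<And>x. x \<in> carrier G \<Longrightarrow> \<tau> x ` W \<subseteq> W"
  have "\<zeta> \<noteq> \<eta>" using assms \<zeta>_mult_\<eta> by (auto simp: power2_eq_square)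
  \<comment> \<open>The operator \<open>\<tau> r - \<eta>\<close> kills \<open>f\<close> and so isolates the component along \<open>e\<close>.\<close>
  have full: "H \<subseteq> W" if w: "vec p q \<in> W" "p \<noteq> 0" for p q
  proof -
    have "vec (\<zeta> * p) (\<eta> * q) \<in> W"
      using inv[OF r_closed] w(1) by (metis image_subset_iff rep_r_vec)
    moreover have "scl (- \<eta>) (vec p q) \<in> W"
      using W(1) w(1) by (rule subspace_scale)
    ultimately have "vec (\<zeta> * p) (\<eta> * q) + scl (- \<eta>) (vec p q) \<in> W"
      using W(1) subspace_add by blast
    then have "vec ((\<zeta> - \<eta>) * p) 0 \<in> W"
      by (simp add: scale_vec add_vec algebra_simps)
    then have "scl (inverse ((\<zeta> - \<eta>) * p)) (vec ((\<zeta> - \<eta>) * p) 0) \<in> W"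
      using W(1) by (intro subspace_scale)
    moreover have "inverse ((\<zeta> - \<eta>) * p) * ((\<zeta> - \<eta>) * p) = 1"
      using \<open>\<zeta> \<noteq> \<eta>\<close> w(2) by (intro left_inverse) simp
    ultimately have "vec 1 0 \<in> W" by (simp add: scale_vec)
    then have e_W: "e \<in> W" by (simp only: vec_axes)
    then have "f \<in> W" using inv[OF s_closed] by (metis image_subset_iff)
    with e_W have "{e, f} \<subseteq> W" by simp
    then show ?thesis
      using H_span span_minimal[OF _ W(1)] by (metis order_trans)
  qed
  show "W = {0} \<or> W = H"
  proof (rule disjCI)
    assume "W \<noteq> H"
    have "w = 0" if w_W: "w \<in> W" for w
    proof -
      obtain p q where w: "w = vec p q" using H_cases[OF subsetD[OF W(2) w_W]] .
      have "vec q p \<in> W"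
        using inv[OF s_closed] w_W by (metis image_subset_iff rep_s_vec w)
      then have "p = 0" "q = 0" using full \<open>W \<noteq> H\<close> W(2) w_W w by blast+
      then show ?thesis by (simp add: w)
    qed
    then show "W = {0}" using subspace_0[OF W(1)] by auto
  qed
qed

text \<open>
  For \<open>n = 2 * m\<close> the rotation \<open>r ^ m\<close> is central and acts as a scalar: its eigenvalues \<open>\<zeta> ^ m\<close> and
  \<open>\<eta> ^ m\<close> are mutually inverse and square to \<open>1\<close>, so they are equal.
\<close>

lemma not_haar_property_even:
  assumes "even n" "v \<in> H"
  shows "\<not> haar_property G scl H \<tau> v"
proof -
  obtain m where m: "n = 2 * m" using assms(1) by blast
  obtain p q where v: "v = vec p q" using H_cases assms(2) by blast
  have "\<zeta> ^ m * \<zeta> ^ m = \<zeta> ^ m * \<eta> ^ m"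
    using \<zeta>_pow_n \<zeta>_pow_mult_\<eta>_pow[of m] by (simp add: m mult_2 power_add)
  then have "\<zeta> ^ m = \<eta> ^ m" using \<zeta>_nonzero by simp
  then have "\<tau> (normal_form m False) v = scl (\<zeta> ^ m) (\<tau> \<one> v)"
    using rep_one[OF assms(2)] by (simp add: v rep_vec scale_vec)
  moreover have "normal_form m False \<noteq> normal_form 0 False"
    using n_gt_2 m normal_form_eq_iff[of m False 0 False] by auto
  ultimately show ?thesis
    by (intro not_haar_property_if_scalar[of "normal_form m False" \<one> v "\<zeta> ^ m"])
      (simp_all add: normal_form_special)
qed

end

section \<open>Irreducible representations of dimension at least two\<close>

text \<open>
  Let \<open>e\<close> be an eigenvector of the rotation. The span of \<open>e\<close> and \<open>\<tau> s e\<close> is invariant, hence all of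
  \<open>H\<close>; if the two vectors were proportional, \<open>H\<close> would be a line. If \<open>\<zeta>\<^sup>2 = 1\<close>, the rotation is a scalar
  and the line through \<open>e + \<tau> s e\<close> is invariant, contradicting irreducibility.
\<close>

lemma (in dihedral_rep) irreducible_eigenbasis:
  assumes irr: "irreducible_unitary_rep G scl H ip \<tau>" and "dim H \<noteq> 1"
  obtains e \<zeta> where "dihedral_plane n G r s scl H ip \<tau> e \<zeta>" "\<zeta>\<^sup>2 \<noteq> 1"
proof -
  interpret irr: irreducible_unitary_rep G scl H ip \<tau> by (fact irr)
  have "n > 0" using n_gt_2 by simp
  then obtain e \<zeta> where e: "e \<in> H" "e \<noteq> 0" and r_e: "\<tau> r e = scl \<zeta> e"
    using finite_order_eigenvector[OF r_closed r_pow _ irr.nonzero] by metis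
  let ?f = "\<tau> s e"
  have f: "?f \<in> H" by (rule rep_in_H[OF s_closed e(1)])
  have s_f: "\<tau> s ?f = e"
    using rep_mult[OF s_closed s_closed e(1)] by (simp only: s_mult_s rep_one[OF e(1)])
  have full: "span B = H"
    if "B \<subseteq> H" "\<And>b. b \<in> B \<Longrightarrow> \<tau> r b \<in> span B" "\<And>b. b \<in> B \<Longrightarrow> \<tau> s b \<in> span B"
      and "w \<in> B" "w \<noteq> 0" for B w
  proof -
    have "span B = {0} \<or> span B = H"
      by (rule irr.irreducible[OF subspace_span span_minimal[OF that(1) subspace_H]])
        (rule span_invariant[OF that(1-3)])
    moreover have "span B \<noteq> {0}" using span_base[OF that(4)] that(5) by auto
    ultimately show ?thesis by simp
  qed
  have f_notin: "?f \<notin> span {e}"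
  proof
    assume "?f \<in> span {e}"
    then have "span {e} = H"
      using e by (intro full[of "{e}" e]) (auto simp: r_e span_base span_scale)
    moreover have "dim (span {e}) = card {e}"
      unfolding dim_span by (rule dim_eq_card_independent) (use e in simp)
    ultimately show False using assms(2) by simp
  qed
  have neq: "e \<noteq> ?f" using span_base[of e "{e}"] f_notin by auto
  have "independent {?f, e}"
    by (rule independent_insertI[OF f_notin]) (use e(2) in simp)
  then have ind: "independent {e, ?f}" by (subst insert_commute)
  have sp: "span {e, ?f} = H"
    using e f
    by (intro full[of "{e, ?f}" e])
      (auto simp: r_e s_f rep_r_reflected_eigenvector[OF e(1) r_e] span_base span_scale)
  interpret P: dihedral_plane n G r s scl H ip \<tau> e \<zeta>
    by unfold_locales (rule e(1) r_e ind neq equalityD2[OF sp])+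
  have "\<zeta>\<^sup>2 \<noteq> 1"
  proof
    assume "\<zeta>\<^sup>2 = 1"
    then have "\<zeta> * \<zeta> = \<zeta> * P.\<eta>" using P.\<zeta>_mult_\<eta> by (simp add: power2_eq_square)
    then have "P.\<eta> = \<zeta>" using P.\<zeta>_nonzero by simp
    then have "\<tau> r (P.vec 1 1) = scl \<zeta> (P.vec 1 1)" "\<tau> s (P.vec 1 1) = P.vec 1 1"
      by (simp_all add: P.rep_r_vec P.rep_s_vec P.scale_vec)
    then have "span {P.vec 1 1} = H"
      by (intro full[of "{P.vec 1 1}" "P.vec 1 1"]) (auto simp: span_base span_scale)
    then have "P.vec 1 0 \<in> span {P.vec 1 1}" by simp
    then show False by (auto simp: span_singleton P.scale_vec)
  qed
  with P.dihedral_plane_axioms show thesis by (rule that)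
qed

text \<open>
  The exponents \<open>2 * m\<close> and \<open>n\<close> are coprime, so if both powers of \<open>z\<close> were \<open>1\<close>, then \<open>z\<close> would be \<open>1\<close>.
\<close>

lemma even_power_neq_1_if_prime:
  fixes z :: complex
  assumes "prime n" "n > 2" "z ^ n = 1" "z\<^sup>2 \<noteq> 1" "0 < m" "m < n"
  shows "z ^ (2 * m) \<noteq> 1"
proof
  assume z: "z ^ (2 * m) = 1"
  have "\<not> n dvd 2 * m"
    using assms by (auto simp: prime_dvd_mult_iff dest: dvd_imp_le)
  then have "coprime (2 * m) n"
    using assms(1) by (metis coprime_commute prime_imp_coprime)
  then obtain x y where xy: "(2 * m) * x = n * y + 1"
    using coprime_bezout_strong[of "2 * m" n] assms by auto
  have "1 = (z ^ (2 * m)) ^ x" unfolding z by simp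
  also have "\<dots> = z ^ ((2 * m) * x)" by (rule power_mult[symmetric])
  also have "\<dots> = z" unfolding xy by (simp only: power_add power_mult assms(3)) simp
  finally show False using assms(4) by simp
qed

section \<open>A model for every eigenvalue\<close>

definition pointwise_scale :: "complex \<Rightarrow> (nat \<Rightarrow> complex) \<Rightarrow> nat \<Rightarrow> complex" where
  "pointwise_scale c v = (\<lambda>i. c * v i)"

definition first_two :: "(nat \<Rightarrow> complex) set" where
  "first_two = {v. \<forall>i\<ge>2. v i = 0}"

definition first_two_ip :: "(nat \<Rightarrow> complex) \<Rightarrow> (nat \<Rightarrow> complex) \<Rightarrow> complex" where
  "first_two_ip u v = u 0 * cnj (v 0) + u 1 * cnj (v 1)"

definition unit_at :: "nat \<Rightarrow> nat \<Rightarrow> complex" where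
  "unit_at j = (\<lambda>i. if i = j then 1 else 0)"

definition rotation_reflection ::
  "complex \<Rightarrow> nat \<Rightarrow> bool \<Rightarrow> (nat \<Rightarrow> complex) \<Rightarrow> nat \<Rightarrow> complex" where
  "rotation_reflection \<zeta> k b v = (\<lambda>i.
     if i = 0 then \<zeta> ^ k * (if b then v 1 else v 0)
     else if i = 1 then cnj \<zeta> ^ k * (if b then v 0 else v 1) else 0)"

lemma first_two_eqI: "u \<in> first_two \<Longrightarrow> v \<in> first_two \<Longrightarrow> u 0 = v 0 \<Longrightarrow> u 1 = v 1 \<Longrightarrow> u = v"
proof
  fix i assume "u \<in> first_two" "v \<in> first_two" "u 0 = v 0" "u 1 = v 1"
  then show "u i = v i"
    by (cases "i = 0 \<or> i = 1") (auto simp: first_two_def)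
qed

lemma rotation_reflection_simps [simp]:
  "rotation_reflection \<zeta> k b v \<in> first_two"
  "rotation_reflection \<zeta> k b v 0 = \<zeta> ^ k * (if b then v 1 else v 0)"
  "rotation_reflection \<zeta> k b v (Suc 0) = cnj \<zeta> ^ k * (if b then v 0 else v 1)"
  by (simp_all add: rotation_reflection_def first_two_def)

lemma unit_at_in_first_two: "unit_at 0 \<in> first_two" "unit_at 1 \<in> first_two"
  by (auto simp: unit_at_def first_two_def)

interpretation pointwise: vector_space pointwise_scale
  by standard (auto simp: pointwise_scale_def fun_eq_iff algebra_simps)

lemma subspace_first_two: "pointwise.subspace first_two"
  by (auto simp: pointwise.subspace_def first_two_def pointwise_scale_def)

lemma first_two_decompose:
  "v \<in> first_two \<Longrightarrow> v = pointwise_scale (v 0) (unit_at 0) + pointwise_scale (v 1) (unit_at 1)"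
  by (rule first_two_eqI)
    (auto simp: first_two_def pointwise_scale_def unit_at_def)

lemma span_unit_at: "pointwise.span {unit_at 0, unit_at 1} = first_two"
proof
  show "pointwise.span {unit_at 0, unit_at 1} \<subseteq> first_two"
    using unit_at_in_first_two subspace_first_two by (intro pointwise.span_minimal) auto
  have "pointwise_scale a (unit_at 0) + pointwise_scale b (unit_at 1)
      \<in> pointwise.span {unit_at 0, unit_at 1}" for a b
    by (intro pointwise.span_add pointwise.span_scale pointwise.span_base) auto
  then show "first_two \<subseteq> pointwise.span {unit_at 0, unit_at 1}"
    using first_two_decompose by (metis subsetI)
qed

interpretation first_two: fin_dim_unitary_space pointwise_scale first_two first_two_ip
proof
  show "pointwise.subspace first_two" by (rule subspace_first_two)
  show "\<exists>B. finite B \<and> pointwise.span B = first_two"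
    using span_unit_at by (intro exI[of _ "{unit_at 0, unit_at 1}"]) simp
next
  fix u :: "nat \<Rightarrow> complex" assume u: "u \<in> first_two" "u \<noteq> 0"
  then have "u 0 \<noteq> 0 \<or> u 1 \<noteq> 0" using first_two_eqI[of u 0] by (auto simp: first_two_def)
  moreover have "Re (first_two_ip u u) = (cmod (u 0))\<^sup>2 + (cmod (u 1))\<^sup>2"
    by (simp add: first_two_ip_def complex_mult_cnj cmod_power2)
  ultimately show "Re (first_two_ip u u) > 0"
    by (auto intro: add_pos_nonneg add_nonneg_pos)
qed (auto simp: first_two_ip_def pointwise_scale_def algebra_simps)

lemma unitary_rotation_reflection:
  assumes "cmod \<zeta> = 1"
  shows "unitary_operator pointwise_scale first_two first_two_ip (rotation_reflection \<zeta> k b)"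
proof -
  have 1: "\<zeta> ^ k * cnj \<zeta> ^ k = 1"
    using assms by (simp add: complex_norm_square[symmetric] flip: power_mult_distrib)
  have "u \<in> rotation_reflection \<zeta> k b ` first_two" if "u \<in> first_two" for u
  proof
    \<comment> \<open>\<open>w\<close> undoes the phases \<open>\<zeta> ^ k\<close> and \<open>cnj \<zeta> ^ k\<close> and then the swap.\<close>
    define w where "w = (\<lambda>i::nat. if i = (if b then 1 else 0) then cnj \<zeta> ^ k * u 0
      else if i = (if b then 0 else 1) then \<zeta> ^ k * u 1 else 0)"
    show "w \<in> first_two" by (auto simp: w_def first_two_def)
    show "u = rotation_reflection \<zeta> k b w"
      by (rule first_two_eqI[OF that])
        (use 1 in \<open>auto simp: w_def mult.assoc[symmetric] mult.commute[of "cnj \<zeta> ^ k"]\<close>)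
  qed
  moreover have "first_two_ip (rotation_reflection \<zeta> k b u) (rotation_reflection \<zeta> k b v)
      = (\<zeta> ^ k * cnj \<zeta> ^ k) * first_two_ip u v" for u v
    by (simp add: first_two_ip_def algebra_simps)
  moreover have "rotation_reflection \<zeta> k b (u + v)
      = rotation_reflection \<zeta> k b u + rotation_reflection \<zeta> k b v" for u v
    by (rule ext) (simp add: rotation_reflection_def algebra_simps)
  moreover have "rotation_reflection \<zeta> k b (pointwise_scale c u)
      = pointwise_scale c (rotation_reflection \<zeta> k b u)" for c u
    by (rule ext) (simp add: rotation_reflection_def pointwise_scale_def algebra_simps)
  ultimately show ?thesis
    unfolding unitary_operator_def using 1 by (auto simp del: One_nat_def)
qed

context dihedral_group
begin

text \<open>
  The operator of an element is read off from its unique normal form with exponent below \<open>n\<close>.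
\<close>

definition standard_rep :: "complex \<Rightarrow> 'a \<Rightarrow> (nat \<Rightarrow> complex) \<Rightarrow> nat \<Rightarrow> complex" where
  "standard_rep \<zeta> x =
     case_prod (rotation_reflection \<zeta>) (inv_into ({..<n} \<times> UNIV) (case_prod normal_form) x)"

lemma standard_rep_normal_form:
  assumes "n > 0" "\<zeta> ^ n = 1"
  shows "standard_rep \<zeta> (normal_form k b) = rotation_reflection \<zeta> k b"
proof -
  have mod: "w ^ (k mod n) = w ^ k" if "w ^ n = 1" for w :: complex
  proof -
    have "w ^ k = w ^ (n * (k div n) + k mod n)" by simp
    also have "\<dots> = w ^ (k mod n)" by (simp only: power_add power_mult that power_one mult_1)
    finally show ?thesis by simp
  qed
  have cnj: "cnj \<zeta> ^ n = 1" using assms(2) by (metis complex_cnj_one complex_cnj_power)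
  have "rotation_reflection \<zeta> (k mod n) b = rotation_reflection \<zeta> k b"
    by (intro ext) (simp only: rotation_reflection_def mod[OF assms(2)] mod[OF cnj])
  moreover have "inv_into ({..<n} \<times> UNIV) (case_prod normal_form) (normal_form k b) = (k mod n, b)"
    using inv_into_f_f[OF inj_on_normal_form[OF assms(1)], of "(k mod n, b)"] assms(1)
    by (simp add: normal_form_mod)
  ultimately show ?thesis by (simp add: standard_rep_def)
qed

text \<open>
  For every \<open>\<zeta>\<close> of modulus one with \<open>\<zeta> ^ n = 1\<close> the operators \<open>diag (\<zeta>, cnj \<zeta>)\<close> and the coordinate swap
  satisfy the dihedral relations.
\<close>

lemma dihedral_plane_standard_rep:
  assumes n: "n > 2" and \<zeta>: "\<zeta> ^ n = 1" "cmod \<zeta> = 1"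
  shows "dihedral_plane n G r s pointwise_scale first_two first_two_ip
    (standard_rep \<zeta>) (unit_at 0) \<zeta>"
proof -
  have n0: "n > 0" using n by simp
  note rep = standard_rep_normal_form[OF n0 \<zeta>(1)]
  have "\<zeta> * cnj \<zeta> = 1" using \<zeta>(2) by (simp add: complex_norm_square[symmetric])
  moreover have "\<zeta> * \<zeta> ^ (n - 1) = 1" using \<zeta>(1) n by (simp flip: power_Suc)
  moreover have "\<zeta> \<noteq> 0" using \<zeta>(2) by auto
  ultimately have cnj: "\<zeta> ^ (n - 1) = cnj \<zeta>" by (metis mult_left_cancel)
  then have cnj': "cnj \<zeta> ^ (n - 1) = \<zeta>" by (metis complex_cnj_cnj complex_cnj_power)
  have unit: "unitary_operator pointwise_scale first_two first_two_ip (standard_rep \<zeta> x)"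
    if "x \<in> carrier G" for x
    using that carrier_cases[OF n0] by (metis rep unitary_rotation_reflection[OF \<zeta>(2)])
  have mult: "standard_rep \<zeta> (x \<otimes> y) v = standard_rep \<zeta> x (standard_rep \<zeta> y v)"
    if xy: "x \<in> carrier G" "y \<in> carrier G" for x y v
  proof -
    obtain k b where x: "x = normal_form k b" using xy(1) carrier_cases[OF n0] by metis
    obtain l c where y: "y = normal_form l c" using xy(2) carrier_cases[OF n0] by metis
    show ?thesis
      unfolding x y normal_form_mult rep
      by (rule first_two_eqI)
        (auto simp: power_add power_mult cnj[unfolded One_nat_def] cnj'[unfolded One_nat_def])
  qed
  have r_op: "standard_rep \<zeta> r = rotation_reflection \<zeta> 1 False"
    using rep[of 1 False] by (simp only: normal_form_special)
  have s_op: "standard_rep \<zeta> s = rotation_reflection \<zeta> 0 True"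
    using rep[of 0 True] by (simp only: normal_form_special)
  have s_e: "standard_rep \<zeta> s (unit_at 0) = unit_at 1"
    unfolding s_op
    by (rule first_two_eqI[OF rotation_reflection_simps(1) unit_at_in_first_two(2)])
      (simp_all add: unit_at_def)
  have r_e: "standard_rep \<zeta> r (unit_at 0) = pointwise_scale \<zeta> (unit_at 0)"
    unfolding r_op
    by (rule first_two_eqI[OF rotation_reflection_simps(1)
          pointwise.subspace_scale[OF subspace_first_two unit_at_in_first_two(1)]])
      (simp_all add: unit_at_def pointwise_scale_def)
  have neq: "unit_at 0 \<noteq> unit_at 1" by (metis unit_at_def zero_neq_one)
  have "unit_at 0 \<notin> pointwise.span {unit_at 1}"
  proof
    assume "unit_at 0 \<in> pointwise.span {unit_at 1}"
    then obtain c where "unit_at 0 = pointwise_scale c (unit_at 1)"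
      unfolding pointwise.span_singleton by blast
    then have "unit_at 0 0 = pointwise_scale c (unit_at 1) 0" by simp
    then show False by (simp add: unit_at_def pointwise_scale_def)
  qed
  moreover have "unit_at 1 \<noteq> 0" by (auto simp: unit_at_def fun_eq_iff)
  ultimately have ind: "pointwise.independent {unit_at 0, unit_at 1}"
    by (simp add: pointwise.independent_insert)
  show ?thesis
  proof (unfold_locales, goal_cases)
    case (1 x) then show ?case by (rule unit)
  next
    case (2 x y v) then show ?case by (intro mult)
  qed (use n unit_at_in_first_two r_e s_e ind neq span_unit_at in \<open>simp_all del: One_nat_def\<close>)
qed

end

section \<open>The Haar property for dihedral groups\<close>

theorem theorem2:
  fixes n :: nat and G :: "('g, 'm) monoid_scheme" and r s :: 'g
  assumes "n > 2" and "dihedral_group n G r s"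
  shows
    "(\<forall>(scl :: complex \<Rightarrow> 'v::ab_group_add \<Rightarrow> 'v) H ip \<tau>.
        irreducible_unitary_rep G scl H ip \<tau> \<longrightarrow>
          (vector_space.dim scl H = 1 \<longrightarrow>
             (\<forall>z\<in>H. z \<noteq> 0 \<longrightarrow> haar_property G scl H \<tau> z)) \<and>
          (vector_space.dim scl H \<noteq> 1 \<and> prime n \<longrightarrow>
             almost_every_vector scl H (\<lambda>v. haar_property G scl H \<tau> v)) \<and>
          (vector_space.dim scl H \<noteq> 1 \<and> even n \<longrightarrow>
             \<not> (\<exists>v\<in>H. haar_property G scl H \<tau> v))) \<and>
     (odd n \<and> \<not> prime n \<longrightarrow>
        (\<exists>(scl :: complex \<Rightarrow> (nat \<Rightarrow> complex) \<Rightarrow> (nat \<Rightarrow> complex)) H ip \<tau>'.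
           irreducible_unitary_rep G scl H ip \<tau>' \<and>
           (\<forall>v\<in>H. \<not> haar_property G scl H \<tau>' v)) \<and>
        (\<exists>(scl :: complex \<Rightarrow> (nat \<Rightarrow> complex) \<Rightarrow> (nat \<Rightarrow> complex)) H ip \<tau>''.
           irreducible_unitary_rep G scl H ip \<tau>'' \<and>
           almost_every_vector scl H (\<lambda>v. haar_property G scl H \<tau>'' v)))"
proof (intro conjI[where P = "\<forall>scl H ip \<tau>. _ scl H ip \<tau>"] allI impI)
  fix scl :: "complex \<Rightarrow> 'v \<Rightarrow> 'v" and H ip and \<tau> :: "'g \<Rightarrow> 'v \<Rightarrow> 'v"
  assume irr: "irreducible_unitary_rep G scl H ip \<tau>"
  have rep: "unitary_rep G scl H ip \<tau>"
    using irr by (rule irreducible_unitary_rep.axioms(1))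
  have dih: "dihedral_rep n G r s scl H ip \<tau>"
    using assms rep by (intro dihedral_rep.intro dihedral_rep_axioms.intro)
  have dim1: "haar_property G scl H \<tau> z"
    if "vector_space.dim scl H = 1" "z \<in> H" "z \<noteq> 0" for z
    using unitary_rep.haar_property_dim_1[OF rep that] .
  have pr: "almost_every_vector scl H (haar_property G scl H \<tau>)"
    if d: "vector_space.dim scl H \<noteq> 1" and p: "prime n"
  proof -
    obtain e \<zeta> where P: "dihedral_plane n G r s scl H ip \<tau> e \<zeta>" and \<zeta>: "\<zeta>\<^sup>2 \<noteq> 1"
      using dihedral_rep.irreducible_eigenbasis[OF dih irr d] by blast
    show ?thesis
      by (rule dihedral_plane.almost_every_vector_haar_property[OF P])
        (rule even_power_neq_1_if_prime[OF p assms(1) dihedral_plane.\<zeta>_pow_n[OF P] \<zeta>])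
  qed
  have ev: "\<not> haar_property G scl H \<tau> v"
    if d: "vector_space.dim scl H \<noteq> 1" and "even n" "v \<in> H" for v
  proof -
    obtain e \<zeta> where P: "dihedral_plane n G r s scl H ip \<tau> e \<zeta>"
      using dihedral_rep.irreducible_eigenbasis[OF dih irr d] by blast
    show ?thesis by (rule dihedral_plane.not_haar_property_even[OF P that(2,3)])
  qed
  show "(vector_space.dim scl H = 1 \<longrightarrow>
             (\<forall>z\<in>H. z \<noteq> 0 \<longrightarrow> haar_property G scl H \<tau> z)) \<and>
          (vector_space.dim scl H \<noteq> 1 \<and> prime n \<longrightarrow>
             almost_every_vector scl H (\<lambda>v. haar_property G scl H \<tau> v)) \<and>
          (vector_space.dim scl H \<noteq> 1 \<and> even n \<longrightarrow>
             \<not> (\<exists>v\<in>H. haar_property G scl H \<tau> v))"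
    using dim1 pr ev by blast
next
  interpret dihedral_group n G r s by (fact assms(2))
  assume n: "odd n \<and> \<not> prime n"
  define \<omega> where "\<omega> = cis (2 * pi / real n)"
  have \<omega>_pow: "\<omega> ^ k = 1 \<longleftrightarrow> n dvd k" for k
    unfolding \<omega>_def using assms(1) by (intro cis_power_eq_1_iff) simp
  have n_dvd: "n dvd 2 * m \<longleftrightarrow> n dvd m" for m
    using n by (simp add: coprime_dvd_mult_right_iff)
  have "n \<noteq> 1" using assms(1) by simp
  then obtain p where p: "prime p" "p dvd n" using prime_factor_nat by blast
  then obtain q where pq: "n = p * q" by blast
  have q: "1 < q" "q < n" "odd q"
  proof -
    show "odd q" using n pq by simp
    have "q \<noteq> 1" using n p pq by auto
    with \<open>odd q\<close> show "1 < q" by (cases q) auto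
    then show "q < n" using prime_gt_1_nat[OF p(1)] by (simp add: pq)
  qed
  \<comment> \<open>The order of \<open>\<zeta>\<close> is the proper divisor \<open>q\<close> of \<open>n\<close>, so the rotation \<open>r ^ q \<noteq> 1\<close> will act trivially.\<close>
  define \<zeta> where "\<zeta> = \<omega> ^ p"
  have \<zeta>_pow: "\<zeta> ^ k = 1 \<longleftrightarrow> q dvd k" for k
    using \<omega>_pow[of "p * k"] prime_gt_0_nat[OF p(1)] by (simp add: \<zeta>_def pq flip: power_mult)
  interpret A: dihedral_plane n G r s pointwise_scale first_two first_two_ip
    "standard_rep \<zeta>" "unit_at 0" \<zeta>
    by (rule dihedral_plane_standard_rep[OF assms(1)])
      (use \<zeta>_pow[of n] in \<open>auto simp: pq \<zeta>_def \<omega>_def norm_power\<close>)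
  have "\<not> haar_property G pointwise_scale first_two (standard_rep \<zeta>) v"
    if v: "v \<in> first_two" for v
  proof -
    obtain a b where ab: "v = A.vec a b" using A.H_cases[OF v] by blast
    have "\<zeta> ^ q = 1" by (simp add: \<zeta>_pow)
    moreover from this have "A.\<eta> ^ q = 1" using A.\<zeta>_pow_mult_\<eta>_pow[of q] by simp
    ultimately have "standard_rep \<zeta> (normal_form q False) v = v"
      by (simp add: ab A.rep_vec)
    then have "standard_rep \<zeta> (normal_form q False) v = pointwise_scale 1 (standard_rep \<zeta> \<one>\<^bsub>G\<^esub> v)"
      by (simp add: A.rep_one[OF v])
    moreover have "normal_form q False \<noteq> normal_form 0 False"
      using q assms(1) by (simp add: normal_form_eq_iff)
    ultimately show ?thesis
      by (intro A.not_haar_property_if_scalar[of "normal_form q False" "\<one>\<^bsub>G\<^esub>" v 1])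
        (simp_all add: normal_form_special)
  qed
  moreover have "irreducible_unitary_rep G pointwise_scale first_two first_two_ip (standard_rep \<zeta>)"
  proof (rule A.irreducible_plane)
    have "q \<noteq> 2" using q(3) by auto
    then have "\<not> q \<le> 2" using q(1) by simp
    then show "\<zeta>\<^sup>2 \<noteq> 1"
      using \<zeta>_pow[of 2] dvd_imp_le[of q 2] by auto
  qed
  \<comment> \<open>For the primitive root \<open>\<omega>\<close> and odd \<open>n\<close>, no power \<open>\<omega> ^ (2 * m)\<close> with \<open>0 < m < n\<close> is \<open>1\<close>.\<close>
  moreover interpret B: dihedral_plane n G r s pointwise_scale first_two first_two_ip
    "standard_rep \<omega>" "unit_at 0" \<omega>
    by (rule dihedral_plane_standard_rep[OF assms(1)]) (auto simp: \<omega>_pow, simp add: \<omega>_def)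
  have "irreducible_unitary_rep G pointwise_scale first_two first_two_ip (standard_rep \<omega>)"
    using \<omega>_pow[of 2] assms(1) by (intro B.irreducible_plane) (auto dest: dvd_imp_le)
  moreover have "almost_every_vector pointwise_scale first_two
      (haar_property G pointwise_scale first_two (standard_rep \<omega>))"
    by (rule B.almost_every_vector_haar_property) (auto simp: \<omega>_pow n_dvd dest: dvd_imp_le)
  ultimately show "(\<exists>(scl :: complex \<Rightarrow> (nat \<Rightarrow> complex) \<Rightarrow> (nat \<Rightarrow> complex)) H ip \<tau>'.
           irreducible_unitary_rep G scl H ip \<tau>' \<and>
           (\<forall>v\<in>H. \<not> haar_property G scl H \<tau>' v)) \<and>
        (\<exists>(scl :: complex \<Rightarrow> (nat \<Rightarrow> complex) \<Rightarrow> (nat \<Rightarrow> complex)) H ip \<tau>''.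
           irreducible_unitary_rep G scl H ip \<tau>'' \<and>
           almost_every_vector scl H (\<lambda>v. haar_property G scl H \<tau>'' v))"
    by blast
qed

end
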